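(* (i) For any $\bm{\gamma}\in\{0,1\}^{\infty}$ and $a\in\mathbb{Z}_{\ge0}$, ${\ast}^{\bm{\gamma}}a+\emptyset^1\cong{\ast}^{\bm{1}}a$. (ii) For any game with activeness $G^g$, $G^g+\emptyset^1={\ast}^{\bm{0}}\mathcal{G}(G^g)+\emptyset^1$. (iii) For any $a,b\in\mathbb{Z}_{\ge0}$: ${\ast}^{\bm{0}}a+{\ast}^{\bm{0}}b={\ast}^{\bm{0}}(a\oplus b)$, ${\ast}^{\bm{0}}a+{\ast}^{\bm{1}}b={\ast}^{\bm{1}}(a\oplus b)$, and ${\ast}^{\bm{1}}a+{\ast}^{\bm{1}}b={\ast}^{\bm{1}}(a\oplus b)$.
   Context: Let $\mathcal{B}=\{0,1\}$. Define $\mathbb{I}_0=\{\emptyset\}\times\mathcal{B}$ and $\mathbb{I}_n=2^{\mathbb{I}_{n-1}}\times\mathcal{B}$ for $n\ge1$; a game with activeness is an element of $\mathbb{I}=\bigcup_{n\ge0}\mathbb{I}_n$. A pair $(G,g)$ is written $G^g$; elements of $G$ are its options, $g=1$ meaning active; $\cong$ denotes identity of elements of $\mathbb{I}$. The outcome $o$ is defined recursively: $o(G^g)=\mathscr{N}$ if $g=1$ and some option has outcome $\mathscr{P}$, and $o(G^g)=\mathscr{P}$ otherwise. The sum is $G^g+H^h=(\{G'^{g'}+H^h:G'^{g'}\in G^g\}\cup\{G^g+H'^{h'}:H'^{h'}\in H^h\})^{\max\{g,h\}}$. $G^g=H^h$ means $o(G^g+X^x)=o(H^h+X^x)$ for all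 games $X^x$. For $\bm{\gamma}\in\mathcal{B}^\infty$, ${\ast}^{\bm{\gamma}}i=\{{\ast}^{\bm{\gamma}}j:0\le j<i\}^{\gamma_i}$ recursively; $\bm{0}=(0,0,\ldots)$, $\bm{1}=(1,1,\ldots)$. $\mathcal{G}(G^g)=\mathrm{mex}\{\mathcal{G}(G'^{g'}):G'^{g'}\in G^g\}$ recursively (Grundy number ignoring activeness), where $\mathrm{mex}\,S=\min(\mathbb{Z}_{\ge0}\setminus S)$. $\oplus$ is bitwise XOR. *)

theory Defs
  imports Main "HOL-Library.FSet"
begin

text \<open>
  A game is a finite set of options together with an activeness bit (\<open>True\<close> is \<open>1\<close>).
  As every level \<open>\<I>\<^sub>n\<close> is finite, each game has finitely many options, so the union
  of all levels is this datatype (\<open>Union_game_level\<close> below), and \<open>=\<close> on it is identity of games.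
\<close>

datatype game = Game (options: "game fset") (active: bool)

fun game_level :: "nat \<Rightarrow> game set" where
  "game_level 0 = {Game {||} g | g. True}"
| "game_level (Suc n) = {Game G g | G g. fset G \<subseteq> game_level n}"

lemma game_level_Suc: "game_level n \<subseteq> game_level (Suc n)"
proof (induction n)
  case 0
  show ?case by auto
next
  case (Suc n)
  then show ?case by fastforce
qed

lemma game_level_mono: "m \<le> n \<Longrightarrow> game_level m \<subseteq> game_level n"
  by (rule lift_Suc_mono_le[of game_level]) (use game_level_Suc in auto)

lemma finite_game_level: "finite (game_level n)"
proof (induction n)
  case 0
  have "game_level 0 = Game {||} ` UNIV" by auto
  then show ?case by simp
next
  case (Suc n)
  have "game_level (Suc n) \<subseteq> (\<lambda>(A, g). Game (Abs_fset A) g) ` (Pow (game_level n) \<times> UNIV)"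
  proof
    fix x assume "x \<in> game_level (Suc n)"
    then obtain G g where "x = Game G g" "fset G \<subseteq> game_level n" by auto
    then show "x \<in> (\<lambda>(A, g). Game (Abs_fset A) g) ` (Pow (game_level n) \<times> UNIV)"
      by (intro image_eqI[of _ _ "(fset G, g)"]) (auto simp: fset_inverse)
  qed
  with Suc show ?case by (meson finite_Pow_iff finite_SigmaI finite_UNIV finite_imageI finite_subset)
qed

lemma Union_game_level: "(\<Union>n. game_level n) = UNIV"
proof -
  have "\<exists>n. x \<in> game_level n" for x
  proof (induction x)
    case (Game G g)
    then obtain f where f: "\<And>x. x |\<in>| G \<Longrightarrow> x \<in> game_level (f x)" by metis
    have "fset G \<subseteq> game_level (Max (f ` fset G))"
    proof
      fix x assume x: "x |\<in>| G"
      then have "f x \<le> Max (f ` fset G)" by simp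
      with f[OF x] game_level_mono show "x \<in> game_level (Max (f ` fset G))" by blast
    qed
    then have "Game G g \<in> game_level (Suc (Max (f ` fset G)))" by simp
    then show ?case by blast
  qed
  then show ?thesis by blast
qed

datatype outcome_type = \<N> | \<P>

primrec outcome :: "game \<Rightarrow> outcome_type" where
  "outcome (Game G g) = (if g \<and> \<P> |\<in>| outcome |`| G then \<N> else \<P>)"

lemma size_option: "x |\<in>| G \<Longrightarrow> size x < size (Game G g)"
  by (simp add: size_fset_overloaded_simps less_Suc_eq_le)
     (metis finite_fset less_imp_le_nat less_Suc_eq_le member_le_sum zero_le le_add1 add.commute plus_1_eq_Suc le_trans)

function game_sum :: "game \<Rightarrow> game \<Rightarrow> game" (infixl "+\<^sub>G" 65) where
  "Game G g +\<^sub>G Game H h =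
     Game (((\<lambda>G'. G' +\<^sub>G Game H h) |`| G) |\<union>| ((\<lambda>H'. Game G g +\<^sub>G H') |`| H)) (max g h)"
  by pat_completeness auto
termination
  by (relation "measure (\<lambda>(x, y). size x + size y)") (use size_option in fastforce)+

definition game_eq :: "game \<Rightarrow> game \<Rightarrow> bool" (infix "=\<^sub>G" 50) where
  "G =\<^sub>G H \<longleftrightarrow> (\<forall>X. outcome (G +\<^sub>G X) = outcome (H +\<^sub>G X))"

function nim :: "(nat \<Rightarrow> bool) \<Rightarrow> nat \<Rightarrow> game" where
  "nim \<gamma> i = Game (nim \<gamma> |`| fset_of_list [0..<i]) (\<gamma> i)"
  by pat_completeness auto
termination
  by (relation "measure snd") (auto simp: fset_of_list_elem)

declare nim.simps [simp del]

definition mex :: "nat set \<Rightarrow> nat" where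
  "mex S = (LEAST n. n \<notin> S)"

primrec grundy :: "game \<Rightarrow> nat" where
  "grundy (Game G g) = mex (fset (grundy |`| G))"

abbreviation zeros :: "nat \<Rightarrow> bool" where "zeros \<equiv> \<lambda>_. False"

abbreviation ones :: "nat \<Rightarrow> bool" where "ones \<equiv> \<lambda>_. True"

end

theory Submission
  imports Defs
begin

text \<open>
  Call a game uniform if it and all its positions carry the same activeness bit.  Two uniform games
  with the same bit and the same Grundy number are equal: moves to a smaller Grundy number can be
  imitated, and moves to a larger one can be reverted without changing the activeness of the whole
  sum.  Since the Grundy number ignores activeness, it is additive with respect to XOR
  as for ordinary impartial games, and every sum in question is uniform.
\<close>

section \<open>XOR and order of natural numbers\<close>

lemma xor_nat_div_2: "Bit_Operations.xor a b div 2 = Bit_Operations.xor (a div 2) (b div 2)"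
  for a b :: nat
  by (rule bit_eqI) (simp add: bit_simps flip: bit_Suc)

lemma less_nat_iff_div_2: "a < b \<longleftrightarrow> a div 2 < b div 2 \<or> a div 2 = b div 2 \<and> even a \<and> odd b"
  for a b :: nat
  by presburger

text \<open>At the highest bit where \<open>c\<close> and the XOR of \<open>a\<close> and
  \<open>b\<close> differ, \<open>c\<close> has 0 and exactly one of \<open>a\<close>,
  \<open>b\<close> has 1. XORing that number with all of \<open>c\<close>, \<open>a\<close>,
  \<open>b\<close> clears this bit and leaves the higher ones, so it decreases. This supplies the
  Nim move that reaches the value \<open>c\<close>.\<close>

lemma less_xor_natD:
  fixes a b c :: nat
  assumes "c < Bit_Operations.xor a b"
  shows "Bit_Operations.xor c b < a \<or> Bit_Operations.xor a c < b"
  using assms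
proof (induction "a + b + c" arbitrary: a b c rule: less_induct)
  case less
  \<comment> \<open>Halving decreases the induction measure strictly only if the numbers are not all
    0.\<close>
  have nz: "a + b > 0" using less.prems by (cases "a + b") auto
  show ?case
  proof (cases "c div 2 < Bit_Operations.xor a b div 2")
    case True
    have "a div 2 + b div 2 + c div 2 < a + b + c"
      using nz by linarith
    from less.hyps[OF this] True show ?thesis
      unfolding less_nat_iff_div_2[of "Bit_Operations.xor c b"]
        less_nat_iff_div_2[of "Bit_Operations.xor a c"] xor_nat_div_2 by blast
  next
    case False
    with less.prems have eq: "c div 2 = Bit_Operations.xor (a div 2) (b div 2)"
      and par: "even c" "odd (Bit_Operations.xor a b)"
      using less_nat_iff_div_2[of c "Bit_Operations.xor a b"] by (auto simp: xor_nat_div_2)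
    \<comment> \<open>The halves agree, so both comparisons are decided by parity: \<open>c\<close>
      is even and exactly one of \<open>a\<close>, \<open>b\<close> is odd.\<close>
    have "Bit_Operations.xor (c div 2) (b div 2) = a div 2"
      "Bit_Operations.xor (a div 2) (c div 2) = b div 2"
      by (simp_all add: eq xor.assoc flip: xor.assoc[of "a div 2" "a div 2"])
    with par show ?thesis
      unfolding less_nat_iff_div_2[of "Bit_Operations.xor c b"]
        less_nat_iff_div_2[of "Bit_Operations.xor a c"] xor_nat_div_2 even_xor_iff by auto
  qed
qed

section \<open>Mex and additivity of Grundy numbers\<close>

lemma mex_eqI: "mex S = n" if "n \<notin> S" "\<And>m. m < n \<Longrightarrow> m \<in> S"
  unfolding mex_def using that by (intro Least_equality) (auto simp: not_less[symmetric])

lemma mex_notin: "mex S \<notin> S" if "finite S"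
  unfolding mex_def by (rule LeastI_ex) (use that ex_new_if_finite infinite_UNIV_nat in blast)

lemma in_if_less_mex: "m < mex S \<Longrightarrow> m \<in> S"
  unfolding mex_def using not_less_Least by blast

lemma grundy_eq_mex: "grundy G = mex (grundy ` fset (options G))"
  by (cases G) simp

lemma grundy_option_neq: "grundy G' \<noteq> grundy G" if "G' |\<in>| options G"
  using mex_notin that
  by (metis finite_fset finite_imageI grundy_eq_mex imageI)

lemma ex_option_grundy:
  assumes "n < grundy G"
  obtains G' where "G' |\<in>| options G" "grundy G' = n"
  using in_if_less_mex[of n "grundy ` fset (options G)"] assms
  by (auto simp: grundy_eq_mex[of G])

lemma size_option_less: "G' |\<in>| options G \<Longrightarrow> size G' < size G"
  by (cases G) (use size_option in auto)

lemma options_game_sum: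
  "options (G +\<^sub>G H) = (\<lambda>G'. G' +\<^sub>G H) |`| options G |\<union>| (\<lambda>H'. G +\<^sub>G H') |`| options H"
  by (cases G; cases H) simp

lemma active_game_sum: "active (G +\<^sub>G H) \<longleftrightarrow> active G \<or> active H"
  by (cases G; cases H) (auto simp: max_def)

lemma outcome_eq_N_iff: "outcome G = \<N> \<longleftrightarrow> active G \<and> (\<exists>G'. G' |\<in>| options G \<and> outcome G' = \<P>)"
  by (cases G) (auto simp: image_iff)

lemma outcome_neq_N_iff: "outcome G \<noteq> \<N> \<longleftrightarrow> outcome G = \<P>"
  by (cases "outcome G") auto

text \<open>The Sprague-Grundy argument. XOR with a fixed number is injective, so no option of the
  sum attains the XOR; by \<open>less_xor_natD\<close> every smaller value is attained by a move in
  one summand.\<close>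

lemma grundy_game_sum: "grundy (G +\<^sub>G H) = Bit_Operations.xor (grundy G) (grundy H)"
proof (induction "size G + size H" arbitrary: G H rule: less_induct)
  case less
  have IH: "grundy (G' +\<^sub>G H) = Bit_Operations.xor (grundy G') (grundy H)"
    if "G' |\<in>| options G" for G'
    using less.hyps size_option_less[OF that] by simp
  have IH': "grundy (G +\<^sub>G H') = Bit_Operations.xor (grundy G) (grundy H')"
    if "H' |\<in>| options H" for H'
    using less.hyps size_option_less[OF that] by simp
  have cancel: "Bit_Operations.xor x z = Bit_Operations.xor y z \<longleftrightarrow> x = y"
    "Bit_Operations.xor z x = Bit_Operations.xor z y \<longleftrightarrow> x = y" for x y z :: nat
    by (metis xor.assoc xor.commute xor_self_eq xor.right_neutral)+
  show ?case
    unfolding grundy_eq_mex[of "G +\<^sub>G H"]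
  proof (rule mex_eqI)
    show "Bit_Operations.xor (grundy G) (grundy H) \<notin> grundy ` fset (options (G +\<^sub>G H))"
    proof
      assume "Bit_Operations.xor (grundy G) (grundy H) \<in> grundy ` fset (options (G +\<^sub>G H))"
      then show False
        by (auto simp: options_game_sum IH IH' cancel) (metis grundy_option_neq)+
    qed
  next
    fix m assume "m < Bit_Operations.xor (grundy G) (grundy H)"
    then consider "Bit_Operations.xor m (grundy H) < grundy G"
      | "Bit_Operations.xor (grundy G) m < grundy H"
      using less_xor_natD by blast
    then show "m \<in> grundy ` fset (options (G +\<^sub>G H))"
    proof cases
      case 1
      then obtain G' where G': "G' |\<in>| options G" "grundy G' = Bit_Operations.xor m (grundy H)"
        by (rule ex_option_grundy)
      then have "grundy (G' +\<^sub>G H) = m"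
        by (simp add: IH xor.assoc)
      with G' show ?thesis by (force simp: options_game_sum)
    next
      case 2
      then obtain H' where H': "H' |\<in>| options H" "grundy H' = Bit_Operations.xor (grundy G) m"
        by (rule ex_option_grundy)
      then have "grundy (G +\<^sub>G H') = m"
        by (simp add: IH' flip: xor.assoc)
      with H' show ?thesis by (force simp: options_game_sum)
    qed
  qed
qed

section \<open>Uniform games\<close>

primrec uniform :: "bool \<Rightarrow> game \<Rightarrow> bool" where
  "uniform c (Game G g) \<longleftrightarrow> g = c \<and> fBall (uniform c |`| G) (\<lambda>b. b)"

text \<open>Primitive recursion through a finite set has to go by its image, so
  \<open>uniform\<close> quantifies over a set of truth values; this is the form used in
  proofs.\<close>

lemma uniform_iff: "uniform c G \<longleftrightarrow> active G = c \<and> (\<forall>G'. G' |\<in>| options G \<longrightarrow> uniform c G')"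
  by (cases G) auto

lemma uniform_game_sum_False: "uniform False (G +\<^sub>G H)" if "uniform False G" "uniform False H"
  using that
proof (induction "size G + size H" arbitrary: G H rule: less_induct)
  case less
  have "uniform False (G' +\<^sub>G H)" if "G' |\<in>| options G" for G'
    using less size_option_less[OF that] that uniform_iff[of False G] by simp
  moreover have "uniform False (G +\<^sub>G H')" if "H' |\<in>| options H" for H'
    using less size_option_less[OF that] that uniform_iff[of False H] by simp
  ultimately show ?case
    using less.prems uniform_iff[of False G] uniform_iff[of False H]
    by (subst uniform_iff) (auto simp: options_game_sum active_game_sum)
qed

text \<open>One uniformly active summand suffices: every position of the sum contains an active
  position of it, and the bit of a sum is the maximum.\<close>

lemma uniform_game_sum_True: "uniform True (G +\<^sub>G H)" if "uniform True G \<or> uniform True H"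
  using that
proof (induction "size G + size H" arbitrary: G H rule: less_induct)
  case less
  have "uniform True (G' +\<^sub>G H)" if "G' |\<in>| options G" for G'
    using less size_option_less[OF that] that uniform_iff[of True G] by auto
  moreover have "uniform True (G +\<^sub>G H')" if "H' |\<in>| options H" for H'
    using less size_option_less[OF that] that uniform_iff[of True H] by auto
  ultimately show ?case
    using less.prems uniform_iff[of True G] uniform_iff[of True H]
    by (subst uniform_iff) (auto simp: options_game_sum active_game_sum)
qed

text \<open>The game \<open>X\<close> is arbitrary, uniform or not, and varies in the induction,
  since a move may also be made in it.\<close>

lemma uniform_outcome_cong:
  assumes "uniform c G" "uniform c H" "grundy G = grundy H"
  shows "outcome (G +\<^sub>G X) = outcome (H +\<^sub>G X)"
  using assms
proof (induction "size G + size H + size X" arbitrary: G H X rule: less_induct)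
  case less
  \<comment> \<open>One direction, with its own copy of the induction hypothesis so that the roles
    of \<open>G\<close> and \<open>H\<close> can be exchanged.\<close>
  have imitate: "outcome (H +\<^sub>G X) = \<N>"
    if N: "outcome (G +\<^sub>G X) = \<N>" and G: "uniform c G" and H: "uniform c H"
      and gr: "grundy G = grundy H"
      and IH: "\<And>G' H' X'. size G' + size H' + size X' < size G + size H + size X \<Longrightarrow> uniform c G'
        \<Longrightarrow> uniform c H' \<Longrightarrow> grundy G' = grundy H' \<Longrightarrow> outcome (G' +\<^sub>G X') = outcome (H' +\<^sub>G X')"
    for G H
  proof -
    \<comment> \<open>Whether the sum is active depends only on \<open>c\<close> and
      \<open>X\<close>, so it survives replacing \<open>G\<close> by any uniform game with bit
      \<open>c\<close>.\<close>
    have act: "c \<or> active X"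
      using N G uniform_iff[of c G] by (auto simp: outcome_eq_N_iff active_game_sum)
    then have actH: "active (H +\<^sub>G X)"
      using H uniform_iff[of c H] by (auto simp: active_game_sum)
    from N consider G' where "G' |\<in>| options G" "outcome (G' +\<^sub>G X) = \<P>"
      | X' where "X' |\<in>| options X" "outcome (G +\<^sub>G X') = \<P>"
      by (auto simp: outcome_eq_N_iff options_game_sum)
    then show ?thesis
    proof cases
      case 1
      have G': "uniform c G'" using G 1(1) uniform_iff[of c G] by blast
      show ?thesis
      proof (cases "grundy G' < grundy H")
        case True
        then obtain H' where H': "H' |\<in>| options H" "grundy H' = grundy G'"
          by (rule ex_option_grundy)
        then have "outcome (H' +\<^sub>G X) = \<P>"
          using IH[of G' H' X] 1 G' H uniform_iff[of c H] size_option_less[of G' G]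
            size_option_less[of H' H] by simp
        with H' actH show ?thesis
          by (auto simp: outcome_eq_N_iff options_game_sum)
      next
        case False
        with grundy_option_neq[OF 1(1)] gr have "grundy H < grundy G'" by simp
        then obtain G'' where G'': "G'' |\<in>| options G'" "grundy G'' = grundy H"
          by (rule ex_option_grundy)
        \<comment> \<open>Activeness matters here: an inactive sum has outcome \<open>\<P>\<close>
          whatever its options, but an active one only if all its options have outcome
          \<open>\<N>\<close>. Hence the reverting move to \<open>G''\<close> gives
          \<open>\<N>\<close>, and \<open>G''\<close> can be exchanged for \<open>H\<close>.\<close>
        have "outcome (G' +\<^sub>G X) \<noteq> \<N>" "active (G' +\<^sub>G X)"
          using 1 G' act uniform_iff[of c G'] by (auto simp: active_game_sum)
        with G''(1) have "outcome (G'' +\<^sub>G X) = \<N>"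
          by (auto simp: outcome_eq_N_iff[of "G' +\<^sub>G X"] options_game_sum
              simp flip: outcome_neq_N_iff)
        then show ?thesis
          using IH[of G'' H X] G'' G' H uniform_iff[of c G'] size_option_less[OF 1(1)]
            size_option_less[OF G''(1)] by simp
      qed
    next
      case 2
      then have "outcome (H +\<^sub>G X') = \<P>"
        using IH[of G H X'] G H gr size_option_less[of X' X] by simp
      with 2 actH show ?thesis
        by (auto simp: outcome_eq_N_iff options_game_sum)
    qed
  qed
  have "outcome (G +\<^sub>G X) = \<N> \<longleftrightarrow> outcome (H +\<^sub>G X) = \<N>"
    using imitate[of G H] imitate[of H G] less by (auto simp: add.commute)
  then show ?case
    by (cases "outcome (G +\<^sub>G X)"; cases "outcome (H +\<^sub>G X)") auto
qed

lemma uniform_game_eqI: "uniform c G \<Longrightarrow> uniform c H \<Longrightarrow> grundy G = grundy H \<Longrightarrow> G =\<^sub>G H"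
  unfolding game_eq_def using uniform_outcome_cong by blast

section \<open>Nim heaps\<close>

lemma options_nim: "fset (options (nim \<gamma> n)) = nim \<gamma> ` {..<n}"
  by (subst nim.simps) (auto simp: fset_of_list.rep_eq)

lemma active_nim: "active (nim \<gamma> n) = \<gamma> n"
  by (subst nim.simps) simp

lemma grundy_nim: "grundy (nim \<gamma> n) = n"
proof (induction n rule: less_induct)
  case (less n)
  then have "grundy ` fset (options (nim \<gamma> n)) = {..<n}"
    by (force simp: options_nim)
  then show ?case
    by (simp add: grundy_eq_mex[of "nim _ _"] mex_eqI)
qed

lemma uniform_nim: "uniform c (nim (\<lambda>_. c) n)"
proof (induction n rule: less_induct)
  case (less n)
  then show ?case
    by (subst uniform_iff) (auto simp: options_nim active_nim)
qed

lemma uniform_active_empty: "uniform True (Game {||} True)"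
  by simp

text \<open>The added game offers no moves and only sets the bit of every position to 1, so the two
  sides are identical, not merely equal as games.\<close>

lemma nim_add_active_empty: "nim \<gamma> n +\<^sub>G Game {||} True = nim ones n"
proof (induction n rule: less_induct)
  case (less n)
  have "fset (options (nim \<gamma> n +\<^sub>G Game {||} True)) = fset (options (nim ones n))"
    using less by (auto simp: options_game_sum options_nim image_image)
  then show ?case
    by (intro game.expand) (simp add: fset_inject active_game_sum active_nim)
qed

theorem theorem3p55:
  "(\<forall>(\<gamma> :: nat \<Rightarrow> bool) (a :: nat). nim \<gamma> a +\<^sub>G Game {||} True = nim ones a) \<and>
   (\<forall>G :: game. G +\<^sub>G Game {||} True =\<^sub>G nim zeros (grundy G) +\<^sub>G Game {||} True) \<and>
   (\<forall>(a :: nat) (b :: nat).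
      nim zeros a +\<^sub>G nim zeros b =\<^sub>G nim zeros (Bit_Operations.xor a b) \<and>
      nim zeros a +\<^sub>G nim ones b =\<^sub>G nim ones (Bit_Operations.xor a b) \<and>
      nim ones a +\<^sub>G nim ones b =\<^sub>G nim ones (Bit_Operations.xor a b))"
proof (intro conjI allI)
  show "nim \<gamma> a +\<^sub>G Game {||} True = nim ones a" for \<gamma> a
    by (rule nim_add_active_empty)
  \<comment> \<open>The common active summand makes both sides uniformly active, and it contributes
    the same Grundy number to each.\<close>
  show "G +\<^sub>G Game {||} True =\<^sub>G nim zeros (grundy G) +\<^sub>G Game {||} True" for G
    by (rule uniform_game_eqI[where c = True])
      (simp_all only: uniform_game_sum_True uniform_active_empty grundy_game_sum grundy_nim simp_thms)
  show "nim zeros a +\<^sub>G nim zeros b =\<^sub>G nim zeros (Bit_Operations.xor a b)" for a b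
    by (rule uniform_game_eqI[where c = False])
      (simp_all only: uniform_game_sum_False uniform_nim grundy_game_sum grundy_nim)
  show "nim zeros a +\<^sub>G nim ones b =\<^sub>G nim ones (Bit_Operations.xor a b)" for a b
    by (rule uniform_game_eqI[where c = True])
      (simp_all only: uniform_game_sum_True uniform_nim grundy_game_sum grundy_nim simp_thms)
  show "nim ones a +\<^sub>G nim ones b =\<^sub>G nim ones (Bit_Operations.xor a b)" for a b
    by (rule uniform_game_eqI[where c = True])
      (simp_all only: uniform_game_sum_True uniform_nim grundy_game_sum grundy_nim simp_thms)
qed

end
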